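(* Let $0<\alpha<1$, $x_\alpha=(2/\alpha)^{1/\alpha}$, and $$U(x)=\begin{cases}\left(\frac{e\alpha}{2}\right)^{2/\alpha}x^2,&|x|\le x_\alpha,\\ \exp\{|x|^\alpha\},&|x|>x_\alpha.\end{cases}$$ The Orlicz space $L_U(\Omega)$ contains the same elements as the space $\mathbf F_\psi(\Omega)$ with $\psi(u)=u^{1/\alpha}$, the norms in these spaces are equivalent, and $$C_{U\psi}\|\xi\|_\psi\le\|\xi\|_U\le C_{\psi U}\|\xi\|_\psi,$$ where $$C_{\psi U}=e^{2/\alpha+2}\Big(1+\frac{e^{1/12}}{\sqrt{2\pi}}\Big)^{1/\alpha}e^{1/\alpha},\qquad C_{U\psi}=\frac1{2^{1/\alpha}}\big(e^{2/\alpha}+1\big)^{-1/\alpha}\alpha^{1/\alpha}e^{1/\alpha}.$$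
   Context: For a $C$-function $U$ (continuous, even, convex, monotonically increasing for $x>0$, $U(0)=0$), the Orlicz space $L_U(\Omega)$ is the family of random variables $\xi$ for which there is $r_\xi>0$ with $EU(\xi/r_\xi)<\infty$, with the Luxemburg norm $\|\xi\|_U=\inf\{r>0:EU(\xi/r)\le1\}$. $\mathbf F_\psi(\Omega)$ is the Banach space of random variables with $\|\xi\|_\psi=\sup_{u\ge1}\frac{(E|\xi|^u)^{1/u}}{\psi(u)}<\infty$. *)

theory Defs
  imports "HOL-Probability.Probability"
begin

text \<open>``Monotonically increasing'' is read strictly on the positive half-line; together with
  evenness and continuity this gives \<open>U x > 0\<close> for \<open>x \<noteq> 0\<close>.\<close>

definition C_function :: "(real \<Rightarrow> real) \<Rightarrow> bool" where
  "C_function U \<longleftrightarrow> continuous_on UNIV U \<and> (\<forall>x. U (- x) = U x) \<and> convex_on UNIV U \<and>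
     strict_mono_on {0<..} U \<and> U 0 = 0"

text \<open>Both spaces are sets of real random variables; variables that agree almost surely are not
  identified. A \<open>C\<close>-function \<open>U\<close> is nonnegative and measurable, so integrability of \<open>U (\<xi> / r)\<close> is the same as
  \<open>E U(\<xi> / r) < \<infinity>\<close>. It is required explicitly because the integral of a non-integrable function
  is \<open>0\<close>.\<close>

definition orlicz_space :: "'a measure \<Rightarrow> (real \<Rightarrow> real) \<Rightarrow> ('a \<Rightarrow> real) set" where
  "orlicz_space M U =
     {\<xi> \<in> borel_measurable M. \<exists>r>0. integrable M (\<lambda>\<omega>. U (\<xi> \<omega> / r))}"

definition luxemburg_norm :: "'a measure \<Rightarrow> (real \<Rightarrow> real) \<Rightarrow> ('a \<Rightarrow> real) \<Rightarrow> real" where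
  "luxemburg_norm M U \<xi> =
     Inf {r. r > 0 \<and> integrable M (\<lambda>\<omega>. U (\<xi> \<omega> / r)) \<and> (\<integral>\<omega>. U (\<xi> \<omega> / r) \<partial>M) \<le> 1}"

definition moment_ratio :: "'a measure \<Rightarrow> (real \<Rightarrow> real) \<Rightarrow> ('a \<Rightarrow> real) \<Rightarrow> real \<Rightarrow> real" where
  "moment_ratio M \<psi> \<xi> u = (\<integral>\<omega>. \<bar>\<xi> \<omega>\<bar> powr u \<partial>M) powr (1 / u) / \<psi> u"

text \<open>The condition \<open>\<parallel>\<xi>\<parallel>\<^sub>\<psi> < \<infinity>\<close>: all moments of order \<open>u \<ge> 1\<close> are finite and the supremum is finite.\<close>

definition F_space :: "'a measure \<Rightarrow> (real \<Rightarrow> real) \<Rightarrow> ('a \<Rightarrow> real) set" where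
  "F_space M \<psi> =
     {\<xi> \<in> borel_measurable M. (\<forall>u\<ge>1. integrable M (\<lambda>\<omega>. \<bar>\<xi> \<omega>\<bar> powr u)) \<and>
        bdd_above (moment_ratio M \<psi> \<xi> ` {1..})}"

definition F_norm :: "'a measure \<Rightarrow> (real \<Rightarrow> real) \<Rightarrow> ('a \<Rightarrow> real) \<Rightarrow> real" where
  "F_norm M \<psi> \<xi> = (SUP u\<in>{1..}. moment_ratio M \<psi> \<xi> u)"

definition equivalent_norms_on :: "'b set \<Rightarrow> ('b \<Rightarrow> real) \<Rightarrow> ('b \<Rightarrow> real) \<Rightarrow> bool" where
  "equivalent_norms_on S p q \<longleftrightarrow> (\<exists>c>0. \<exists>C>0. \<forall>x\<in>S. c * p x \<le> q x \<and> q x \<le> C * p x)"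

definition x_thr :: "real \<Rightarrow> real" where
  "x_thr \<alpha> = (2 / \<alpha>) powr (1 / \<alpha>)"

definition U_exp :: "real \<Rightarrow> real \<Rightarrow> real" where
  "U_exp \<alpha> x = (if \<bar>x\<bar> \<le> x_thr \<alpha> then (exp 1 * \<alpha> / 2) powr (2 / \<alpha>) * x\<^sup>2
                else exp (\<bar>x\<bar> powr \<alpha>))"

definition C_psi_U :: "real \<Rightarrow> real" where
  "C_psi_U \<alpha> = exp (2 / \<alpha> + 2) * (1 + exp (1 / 12) / sqrt (2 * pi)) powr (1 / \<alpha>) * exp (1 / \<alpha>)"

definition C_U_psi :: "real \<Rightarrow> real" where
  "C_U_psi \<alpha> = 1 / 2 powr (1 / \<alpha>) * (exp (2 / \<alpha>) + 1) powr (- 1 / \<alpha>) *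
     \<alpha> powr (1 / \<alpha>) * exp (1 / \<alpha>)"

text \<open>The function \<open>U_exp \<alpha>\<close> is a \<open>C\<close>-function, so it defines an Orlicz space. The two branches
  meet with equal values and slopes at \<open>x_thr \<alpha>\<close>.\<close>

context
  fixes \<alpha> :: real
  assumes alpha: "0 < \<alpha>" "\<alpha> < 1"
begin

private definition "K = (exp 1 * \<alpha> / 2) powr (2 / \<alpha>)"

private definition "g x = (if x \<in> {..x_thr \<alpha>} then K * x\<^sup>2 else exp (x powr \<alpha>))"

private definition "g' x = (if x \<in> {..x_thr \<alpha>} then 2 * K * x
                            else exp (x powr \<alpha>) * (\<alpha> * x powr (\<alpha> - 1)))"

private lemma x_thr_pos: "x_thr \<alpha> > 0"
  using alpha by (simp add: x_thr_def)

private lemma x_thr_powr: "x_thr \<alpha> powr \<alpha> = 2 / \<alpha>"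
  using alpha by (simp add: x_thr_def powr_powr)

private lemma K_pos: "K > 0"
  using alpha by (simp add: K_def)

private lemma value_match: "K * (x_thr \<alpha>)\<^sup>2 = exp (x_thr \<alpha> powr \<alpha>)"
proof -
  have "(x_thr \<alpha>)\<^sup>2 = (2 / \<alpha>) powr (2 / \<alpha>)"
    using alpha by (simp add: x_thr_def power2_eq_square flip: powr_add)
  then have "K * (x_thr \<alpha>)\<^sup>2 = (exp 1 * \<alpha> / 2 * (2 / \<alpha>)) powr (2 / \<alpha>)"
    using alpha unfolding K_def by (subst powr_mult) auto
  also have "\<dots> = exp (2 / \<alpha>)"
    using alpha by (simp add: powr_def)
  finally show ?thesis by (simp add: x_thr_powr)
qed

private lemma slope_match:
  "2 * K * x_thr \<alpha> = exp (x_thr \<alpha> powr \<alpha>) * (\<alpha> * x_thr \<alpha> powr (\<alpha> - 1))"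
proof -
  have "x_thr \<alpha> powr (\<alpha> - 1) = (2 / \<alpha>) / x_thr \<alpha>"
    using x_thr_pos by (simp add: powr_diff x_thr_powr)
  then show ?thesis
    using x_thr_pos alpha by (simp add: value_match[symmetric] power2_eq_square)
qed

private lemma g_deriv: "(g has_real_derivative g' x) (at x)"
proof -
  have UN: "UNIV = {..x_thr \<alpha>} \<union> {x_thr \<alpha><..}" by auto
  have "(g has_vector_derivative g' x) (at x within UNIV)"
    unfolding g_def[abs_def] g'_def
  proof (rule has_vector_derivative_If_within_closures[OF _ UN, of x])
    show "((\<lambda>x. K * x\<^sup>2) has_vector_derivative 2 * K * x)
        (at x within {..x_thr \<alpha>} \<union> (closure {..x_thr \<alpha>} \<inter> closure {x_thr \<alpha><..}))"
      unfolding has_real_derivative_iff_has_vector_derivative[symmetric]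
      by (auto intro!: derivative_eq_intros)
    assume "x \<in> {x_thr \<alpha><..} \<union> (closure {..x_thr \<alpha>} \<inter> closure {x_thr \<alpha><..})"
    then have "x > 0" using x_thr_pos by auto
    then show "((\<lambda>x. exp (x powr \<alpha>)) has_vector_derivative
          exp (x powr \<alpha>) * (\<alpha> * x powr (\<alpha> - 1)))
        (at x within {x_thr \<alpha><..} \<union> (closure {..x_thr \<alpha>} \<inter> closure {x_thr \<alpha><..}))"
      unfolding has_real_derivative_iff_has_vector_derivative[symmetric]
      by (auto intro!: derivative_eq_intros)
  next
    assume "x \<in> closure {..x_thr \<alpha>}" "x \<in> closure {x_thr \<alpha><..}"
    then have "x = x_thr \<alpha>" by simp
    then show "K * x\<^sup>2 = exp (x powr \<alpha>)"
      and "2 * K * x = exp (x powr \<alpha>) * (\<alpha> * x powr (\<alpha> - 1))"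
      using value_match slope_match by auto
  qed auto
  then show ?thesis
    by (simp add: has_real_derivative_iff_has_vector_derivative)
qed

private lemma slope_exp_mono:
  assumes "x_thr \<alpha> \<le> x" "x \<le> y"
  shows "exp (x powr \<alpha>) * (\<alpha> * x powr (\<alpha> - 1)) \<le> exp (y powr \<alpha>) * (\<alpha> * y powr (\<alpha> - 1))"
proof -
  have pos: "0 < x" "0 < y" using assms x_thr_pos by auto
  define t where "t = ln y - ln x"
  have t: "0 \<le> t" using assms pos by (simp add: t_def)
  have ge: "2 / \<alpha> \<le> x powr \<alpha>"
    using assms x_thr_pos alpha powr_mono2[of \<alpha> "x_thr \<alpha>" x] by (simp add: x_thr_powr)
  have "(1 - \<alpha>) * t \<le> 2 * t" using t alpha by (intro mult_right_mono) auto
  also have "\<dots> = 2 / \<alpha> * (\<alpha> * t)" using alpha by simp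
  also have "\<dots> \<le> x powr \<alpha> * (\<alpha> * t)" using ge t alpha by (intro mult_right_mono) auto
  also have "\<dots> \<le> x powr \<alpha> * (exp (\<alpha> * t) - 1)"
  proof (rule mult_left_mono)
    show "\<alpha> * t \<le> exp (\<alpha> * t) - 1" using exp_ge_add_one_self[of "\<alpha> * t"] by linarith
  qed simp
  also have "\<dots> = y powr \<alpha> - x powr \<alpha>"
    using pos by (simp add: powr_def t_def algebra_simps flip: exp_add)
  finally have "x powr \<alpha> + (\<alpha> - 1) * ln x \<le> y powr \<alpha> + (\<alpha> - 1) * ln y"
    by (simp add: t_def algebra_simps)
  then have "exp (x powr \<alpha>) * x powr (\<alpha> - 1) \<le> exp (y powr \<alpha>) * y powr (\<alpha> - 1)"
    using pos by (simp add: powr_def flip: exp_add)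
  then have "\<alpha> * (exp (x powr \<alpha>) * x powr (\<alpha> - 1)) \<le> \<alpha> * (exp (y powr \<alpha>) * y powr (\<alpha> - 1))"
    using alpha by (intro mult_left_mono) auto
  then show ?thesis by (simp add: mult_ac)
qed

private lemma g'_mono: "x \<le> y \<Longrightarrow> g' x \<le> g' y"
proof -
  assume "x \<le> y"
  consider "y \<le> x_thr \<alpha>" | "x \<le> x_thr \<alpha>" "x_thr \<alpha> < y" | "x_thr \<alpha> < x" by linarith
  then show ?thesis
  proof cases
    case 1
    then show ?thesis using \<open>x \<le> y\<close> K_pos by (simp add: g'_def)
  next
    case 2
    have "2 * K * x \<le> 2 * K * x_thr \<alpha>" using 2 K_pos by simp
    also have "\<dots> \<le> exp (y powr \<alpha>) * (\<alpha> * y powr (\<alpha> - 1))"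
      using slope_exp_mono[of "x_thr \<alpha>" y] 2 by (simp add: slope_match)
    finally show ?thesis using 2 by (simp add: g'_def)
  next
    case 3
    then show ?thesis using \<open>x \<le> y\<close> slope_exp_mono[of x y] by (simp add: g'_def)
  qed
qed

private lemma g'_pos: "x > 0 \<Longrightarrow> g' x > 0"
  using K_pos alpha by (auto simp: g'_def)

private lemma g_strict_mono:
  assumes "0 \<le> x" "x < y"
  shows "g x < g y"
proof -
  obtain z where z: "x < z" "z < y" "g y - g x = (y - x) * g' z"
    using MVT2[of x y g g'] assms g_deriv by blast
  have "0 < (y - x) * g' z" using z assms g'_pos[of z] by simp
  then show ?thesis using z by simp
qed

private lemma g_mono: "0 \<le> x \<Longrightarrow> x \<le> y \<Longrightarrow> g x \<le> g y"
  using g_strict_mono[of x y] by (cases "x = y") auto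

private lemma g_convex: "convex_on UNIV g"
  by (rule convex_on_realI[of _ _ g']) (auto intro: g_deriv g'_mono)

private lemma U_exp_eq: "U_exp \<alpha> = (\<lambda>x. g \<bar>x\<bar>)"
  by (auto simp: U_exp_def g_def K_def)

lemma C_function_U_exp: "C_function (U_exp \<alpha>)"
proof -
  have "continuous_on UNIV g"
    by (intro continuous_at_imp_continuous_on ballI) (rule DERIV_isCont[OF g_deriv])
  then have "continuous_on UNIV (\<lambda>x. g \<bar>x\<bar>)"
    by (rule continuous_on_compose2) (auto intro!: continuous_intros)
  moreover have "convex_on UNIV (\<lambda>x. g \<bar>x\<bar>)"
  proof (rule convex_onI)
    fix t x y :: real
    assume t: "0 < t" "t < 1"
    have "\<bar>(1 - t) * x + t * y\<bar> \<le> (1 - t) * \<bar>x\<bar> + t * \<bar>y\<bar>"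
      using t abs_triangle_ineq[of "(1 - t) * x" "t * y"] by (simp add: abs_mult)
    then have "g \<bar>(1 - t) * x + t * y\<bar> \<le> g ((1 - t) * \<bar>x\<bar> + t * \<bar>y\<bar>)"
      by (intro g_mono) auto
    also have "\<dots> \<le> (1 - t) * g \<bar>x\<bar> + t * g \<bar>y\<bar>"
      using convex_onD[OF g_convex, of t "\<bar>x\<bar>" "\<bar>y\<bar>"] t by simp
    finally show "g \<bar>(1 - t) *\<^sub>R x + t *\<^sub>R y\<bar> \<le> (1 - t) * g \<bar>x\<bar> + t * g \<bar>y\<bar>" by simp
  qed auto
  moreover have "strict_mono_on {0<..} (\<lambda>x. g \<bar>x\<bar>)"
    by (auto simp: strict_mono_on_def intro!: g_strict_mono)
  ultimately show ?thesis
    using x_thr_pos by (auto simp: C_function_def U_exp_eq g_def)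
qed

end

end

theory Submission
  imports Defs
begin

text \<open>Put \<open>t = \<bar>x\<bar> powr \<alpha>\<close>. Both norms are compared with the exponential moment of \<open>t\<close>. Up to constants,
  the Orlicz function lies between shifts of that exponential:
  \<open>exp t - exp (2 / \<alpha>) \<le> U_exp \<alpha> x \<le> 3 * (exp t - 1)\<close> (\<open>exp_le_U_exp_add\<close> and
  \<open>U_exp_le_exp_minus_one\<close>). The shift by \<open>1\<close> on the right matters: it makes the bound vanish at the
  origin, so that it can be made small by rescaling the argument.

  From the Orlicz condition to moments: maximising \<open>\<bar>x\<bar> powr u * exp (- t)\<close> over \<open>x\<close> gives
  \<open>\<bar>x\<bar> powr u \<le> (u / (exp 1 * \<alpha>)) powr (u / \<alpha>) * exp t\<close>. Integrating, the \<open>u\<close>-th root is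
  \<open>u powr (1 / \<alpha>)\<close> times a factor that is bounded in \<open>u\<close> (\<open>moments_of_integrable_U_exp\<close>).

  From moments to the Orlicz condition: expand \<open>exp t - 1\<close> into its power series. The \<open>k\<close>-th term is
  a moment of order \<open>\<alpha> * k\<close>, which the moment condition bounds by about \<open>k ^ k\<close>; dividing by \<open>k!\<close> leaves
  \<open>exp k\<close>. Dividing the variable by \<open>c\<close> contributes \<open>(c powr \<alpha>) powr (- k)\<close>, so for
  \<open>c powr \<alpha> \<ge> exp 3\<close> the series is dominated by a geometric series of ratio \<open>1 / 4\<close>, whose sum \<open>1 / 3\<close>
  absorbs the factor \<open>3\<close> (\<open>U_exp_integrable_of_moments\<close>). The constant \<open>C_psi_U \<alpha>\<close> is such a \<open>c\<close>.\<close>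

section \<open>Pointwise comparison of powers, exponentials and the Orlicz function\<close>

text \<open>With \<open>c = u / \<alpha>\<close> and \<open>t = x powr \<alpha>\<close> the left-hand side is \<open>t powr c\<close>, and \<open>t powr c * exp (- t)\<close> is
  largest at \<open>t = c\<close>. This maximum is read off from the tangent inequality \<open>s \<le> exp (s - 1)\<close> at
  \<open>s = t / c\<close>.\<close>

lemma powr_le_exp_powr:
  fixes x u \<alpha> :: real
  assumes "0 \<le> x" "0 < u" "0 < \<alpha>"
  shows "x powr u \<le> (u / (exp 1 * \<alpha>)) powr (u / \<alpha>) * exp (x powr \<alpha>)"
proof -
  define c where "c = u / \<alpha>"
  define t where "t = x powr \<alpha>"
  have c: "c > 0" using assms by (simp add: c_def)
  have "t / c \<le> exp (t / c - 1)"
    using exp_ge_add_one_self[of "t / c - 1"] by simp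
  then have "t \<le> c / exp 1 * exp (t / c)"
    using c by (simp add: exp_diff divide_le_eq mult_ac)
  then have "t powr c \<le> (c / exp 1 * exp (t / c)) powr c"
    using c by (intro powr_mono2) (simp_all add: t_def)
  also have "\<dots> = (c / exp 1) powr c * exp (t / c) powr c"
    by (rule powr_mult)
  also have "exp (t / c) powr c = exp t"
    using c by (simp add: powr_def)
  also have "t powr c = x powr u"
    using assms by (simp add: t_def c_def powr_powr)
  finally show ?thesis by (simp add: c_def t_def mult.commute)
qed

text \<open>The quotient \<open>k ^ k / k!\<close> is a single term of the series of \<open>exp k\<close>.\<close>

lemma power_le_exp_mult_fact: "real k ^ k \<le> exp 1 ^ k * fact k"
proof -
  have "(\<Sum>n\<in>{k}. inverse (fact n) *\<^sub>R real k ^ n) \<le> (\<Sum>n. inverse (fact n) *\<^sub>R real k ^ n)"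
    by (intro sum_le_suminf summable_exp_generic) auto
  then have "real k ^ k / fact k \<le> exp (real k)"
    by (simp add: exp_def field_simps)
  then show ?thesis by (simp add: field_simps flip: exp_of_nat_mult)
qed

lemma U_exp_quadratic_branch:
  fixes x \<alpha> :: real
  assumes "0 < \<alpha>"
  shows "(exp 1 * \<alpha> / 2) powr (2 / \<alpha>) * x\<^sup>2 = (exp 1 * \<alpha> / 2 * \<bar>x\<bar> powr \<alpha>) powr (2 / \<alpha>)"
proof -
  have "(\<bar>x\<bar> powr \<alpha>) powr (2 / \<alpha>) = x\<^sup>2"
    using assms by (cases "x = 0") (auto simp: powr_powr)
  then show ?thesis using assms by (subst powr_mult) auto
qed

lemma U_exp_nonneg: "0 \<le> U_exp \<alpha> x"
  by (simp add: U_exp_def)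

lemma borel_measurable_U_exp:
  assumes "0 < \<alpha>" "\<alpha> < 1"
  shows "U_exp \<alpha> \<in> borel_measurable borel"
  using C_function_U_exp[OF assms] borel_measurable_continuous_onI by (auto simp: C_function_def)

text \<open>The constant of the quadratic branch is the reciprocal of the optimal one in
  \<open>powr_le_exp_powr\<close> for \<open>u = 2\<close>: the parabola touches \<open>exp (\<bar>x\<bar> powr \<alpha>)\<close> from below at the threshold.\<close>

lemma U_exp_le_exp:
  assumes "0 < \<alpha>"
  shows "U_exp \<alpha> x \<le> exp (\<bar>x\<bar> powr \<alpha>)"
proof -
  define K where "K = (exp 1 * \<alpha> / 2) powr (2 / \<alpha>)"
  have inv: "K * (2 / (exp 1 * \<alpha>)) powr (2 / \<alpha>) = 1"
    unfolding K_def using assms by (subst powr_mult[symmetric]) auto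
  have "K * x\<^sup>2 \<le> K * ((2 / (exp 1 * \<alpha>)) powr (2 / \<alpha>) * exp (\<bar>x\<bar> powr \<alpha>))"
    using powr_le_exp_powr[of "\<bar>x\<bar>" 2 \<alpha>] assms by (intro mult_left_mono) (auto simp: K_def)
  also have "\<dots> = exp (\<bar>x\<bar> powr \<alpha>)"
    using inv by (simp flip: mult.assoc)
  finally show ?thesis by (simp add: U_exp_def K_def)
qed

lemma exp_le_U_exp_add:
  assumes "0 < \<alpha>"
  shows "exp (\<bar>x\<bar> powr \<alpha>) \<le> U_exp \<alpha> x + exp (2 / \<alpha>)"
proof (cases "\<bar>x\<bar> \<le> x_thr \<alpha>")
  case True
  then have "\<bar>x\<bar> powr \<alpha> \<le> x_thr \<alpha> powr \<alpha>"
    using assms by (intro powr_mono2) auto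
  also have "\<dots> = 2 / \<alpha>" using assms by (simp add: x_thr_def powr_powr)
  finally have "exp (\<bar>x\<bar> powr \<alpha>) \<le> exp (2 / \<alpha>)" by simp
  then show ?thesis using U_exp_nonneg[of \<alpha> x] by linarith
next
  case False
  then show ?thesis by (simp add: U_exp_def)
qed

text \<open>Subtracting \<open>1\<close> costs a constant factor as soon as \<open>t = \<bar>x\<bar> powr \<alpha>\<close> stays away from \<open>0\<close>. Near \<open>0\<close>
  the quadratic branch is \<open>y powr (2 / \<alpha>)\<close> with \<open>y\<close> proportional to \<open>t\<close>, hence at most \<open>y\<close> as long as
  \<open>y \<le> 1\<close>, while \<open>exp t - 1 \<ge> t\<close>.\<close>

lemma U_exp_le_exp_minus_one:
  assumes "0 < \<alpha>" "\<alpha> < 1"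
  shows "U_exp \<alpha> x \<le> 3 * (exp (\<bar>x\<bar> powr \<alpha>) - 1)"
proof -
  define t where "t = \<bar>x\<bar> powr \<alpha>"
  define y where "y = exp 1 * \<alpha> / 2 * t"
  have t: "0 \<le> t" by (simp add: t_def)
  define E where "E = exp t"
  have et: "1 + t \<le> E" by (simp add: E_def)
  have "exp 1 * \<alpha> \<le> 3 * 1"
    using assms exp_le by (intro mult_mono) auto
  then have yt: "y \<le> 3 / 2 * t"
    unfolding y_def using t by (intro mult_right_mono) auto
  show ?thesis
  proof (cases "\<bar>x\<bar> \<le> x_thr \<alpha> \<and> y \<le> 1")
    case True
    have y0: "0 \<le> y" using assms t by (simp add: y_def)
    have "U_exp \<alpha> x = y powr (2 / \<alpha>)"
      using True U_exp_quadratic_branch[OF assms(1), of x] by (simp add: U_exp_def y_def t_def)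
    also have "\<dots> \<le> y"
      using True y0 assms powr_mono'[of 1 "2 / \<alpha>" y] by simp
    also have "\<dots> \<le> 3 * t" using yt t by simp
    also have "\<dots> \<le> 3 * (E - 1)" using et by simp
    finally show ?thesis by (simp add: t_def E_def)
  next
    case False
    \<comment> \<open>For \<open>t \<ge> 2 / 3\<close> one has \<open>exp t \<ge> 1 + t \<ge> 3 / 2\<close>, that is \<open>exp t \<le> 3 * (exp t - 1)\<close>.\<close>
    have "2 / 3 \<le> t"
    proof (cases "y \<le> 1")
      case True
      then have "x_thr \<alpha> powr \<alpha> \<le> \<bar>x\<bar> powr \<alpha>"
        using False assms by (intro powr_mono2) (auto simp: x_thr_def)
      moreover have "x_thr \<alpha> powr \<alpha> = 2 / \<alpha>" using assms by (simp add: x_thr_def powr_powr)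
      moreover have "2 / 3 \<le> 2 / \<alpha>" using assms by (intro divide_left_mono) auto
      ultimately show ?thesis by (simp add: t_def)
    qed (use yt in linarith)
    then show ?thesis using U_exp_le_exp[OF assms(1), of x] et
      unfolding t_def[symmetric] E_def[symmetric] by (simp add: algebra_simps)
  qed
qed

section \<open>The Orlicz condition controls the moments\<close>

text \<open>The bound \<open>B\<close> is left arbitrary because two values serve: \<open>B = 1\<close> gives the inequality between
  the norms, while the actual expectation gives the inclusion of the spaces, where the expectation is
  finite but possibly larger than \<open>1\<close>.\<close>

lemma (in prob_space) moments_of_integrable_U_exp:
  assumes \<alpha>: "0 < \<alpha>" "\<alpha> < 1" and r: "0 < r" and [measurable]: "\<xi> \<in> borel_measurable M"
    and int: "integrable M (\<lambda>\<omega>. U_exp \<alpha> (\<xi> \<omega> / r))"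
    and B: "(\<integral>\<omega>. U_exp \<alpha> (\<xi> \<omega> / r) \<partial>M) \<le> B" and u: "1 \<le> u"
  shows "integrable M (\<lambda>\<omega>. \<bar>\<xi> \<omega>\<bar> powr u)"
    and "moment_ratio M (\<lambda>u. u powr (1 / \<alpha>)) \<xi> u \<le>
           r * ((B + exp (2 / \<alpha>)) / (exp 1 * \<alpha>)) powr (1 / \<alpha>)"
proof -
  define A where "A = (u / (exp 1 * \<alpha>)) powr (u / \<alpha>)"
  define D where "D = B + exp (2 / \<alpha>)"
  have A: "A \<ge> 0" by (simp add: A_def)
  have bound: "\<bar>\<xi> \<omega>\<bar> powr u \<le> r powr u * (A * (U_exp \<alpha> (\<xi> \<omega> / r) + exp (2 / \<alpha>)))" for \<omega>
  proof -
    have "\<bar>\<xi> \<omega>\<bar> powr u = r powr u * \<bar>\<xi> \<omega> / r\<bar> powr u"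
      using r by (subst powr_mult[symmetric]) auto
    also have "\<bar>\<xi> \<omega> / r\<bar> powr u \<le> A * exp (\<bar>\<xi> \<omega> / r\<bar> powr \<alpha>)"
      unfolding A_def using powr_le_exp_powr u \<alpha> by simp
    also have "\<dots> \<le> A * (U_exp \<alpha> (\<xi> \<omega> / r) + exp (2 / \<alpha>))"
      by (rule mult_left_mono[OF exp_le_U_exp_add[OF \<alpha>(1)] A])
    finally show ?thesis by (simp add: mult_left_mono)
  qed
  have int': "integrable M (\<lambda>\<omega>. r powr u * (A * (U_exp \<alpha> (\<xi> \<omega> / r) + exp (2 / \<alpha>))))"
    using int by simp
  show int_u: "integrable M (\<lambda>\<omega>. \<bar>\<xi> \<omega>\<bar> powr u)"
    by (rule Bochner_Integration.integrable_bound[OF int'])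
      (auto intro!: AE_I2 order_trans[OF bound])
  have "0 \<le> (\<integral>\<omega>. U_exp \<alpha> (\<xi> \<omega> / r) \<partial>M)"
    by (simp add: U_exp_nonneg)
  then have B0: "0 \<le> B" using B by linarith
  have "1 \<le> exp (2 / \<alpha>)" using \<alpha> by simp
  then have D: "1 \<le> D" using B0 unfolding D_def by linarith
  have "(\<integral>\<omega>. \<bar>\<xi> \<omega>\<bar> powr u \<partial>M) \<le> (\<integral>\<omega>. r powr u * (A * (U_exp \<alpha> (\<xi> \<omega> / r) + exp (2 / \<alpha>))) \<partial>M)"
    by (intro integral_mono int_u int' bound)
  also have "\<dots> = r powr u * (A * ((\<integral>\<omega>. U_exp \<alpha> (\<xi> \<omega> / r) \<partial>M) + exp (2 / \<alpha>)))"
    using int by (simp add: prob_space)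
  also have "\<dots> \<le> r powr u * (A * D)"
    using B A by (intro mult_left_mono) (auto simp: D_def)
  finally have "(\<integral>\<omega>. \<bar>\<xi> \<omega>\<bar> powr u \<partial>M) powr (1 / u) \<le> (r powr u * (A * D)) powr (1 / u)"
    using u by (intro powr_mono2) auto
  also have "\<dots> = r * ((u / (exp 1 * \<alpha>)) powr (1 / \<alpha>) * D powr (1 / u))"
    using u r \<alpha> D by (simp add: powr_mult powr_powr A_def)
  \<comment> \<open>The dependence of the last factor on \<open>u\<close> disappears since \<open>D \<ge> 1\<close> and \<open>1 / u \<le> 1 \<le> 1 / \<alpha>\<close>.\<close>
  also have "\<dots> \<le> r * ((u / (exp 1 * \<alpha>)) powr (1 / \<alpha>) * D powr (1 / \<alpha>))"
    using u \<alpha> D r by (intro mult_left_mono powr_mono) (auto simp: field_simps)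
  also have "\<dots> = r * ((D / (exp 1 * \<alpha>)) powr (1 / \<alpha>) * u powr (1 / \<alpha>))"
    using u \<alpha> D by (simp add: powr_mult powr_divide)
  finally show "moment_ratio M (\<lambda>u. u powr (1 / \<alpha>)) \<xi> u \<le>
      r * ((B + exp (2 / \<alpha>)) / (exp 1 * \<alpha>)) powr (1 / \<alpha>)"
    using u unfolding moment_ratio_def D_def by (simp add: divide_le_eq mult.assoc)
qed

section \<open>The moments control the Orlicz condition\<close>

text \<open>Termwise integration of the exponential series, done with the nonnegative integral so that the
  finiteness of the expectation and its bound come out together. The first terms need separate care:
  as \<open>\<alpha> < 1\<close>, the order \<open>\<alpha> * k\<close> may be below \<open>1\<close>, where the moment condition is silent; there the
  moment of order \<open>1\<close> suffices, by \<open>y powr p \<le> 1 + y\<close>. The number \<open>\<rho>\<close> may be any positive bound for the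
  norm, which keeps variables of norm \<open>0\<close> from being an exception.\<close>

lemma (in prob_space) U_exp_integrable_of_moments:
  assumes \<alpha>: "0 < \<alpha>" "\<alpha> < 1" and \<rho>: "0 < \<rho>" and c: "exp 3 \<le> c powr \<alpha>" "0 < c"
    and [measurable]: "\<xi> \<in> borel_measurable M"
    and int: "\<And>u. 1 \<le> u \<Longrightarrow> integrable M (\<lambda>\<omega>. \<bar>\<xi> \<omega>\<bar> powr u)"
    and ratio: "\<And>u. 1 \<le> u \<Longrightarrow> moment_ratio M (\<lambda>u. u powr (1 / \<alpha>)) \<xi> u \<le> \<rho>"
  shows "integrable M (\<lambda>\<omega>. U_exp \<alpha> (\<xi> \<omega> / (c * \<rho>)))"
    and "(\<integral>\<omega>. U_exp \<alpha> (\<xi> \<omega> / (c * \<rho>)) \<partial>M) \<le> 1"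
proof -
  define Y where "Y = (\<lambda>\<omega>. \<bar>\<xi> \<omega>\<bar> / \<rho>)"
  define t where "t = (\<lambda>\<omega>. \<bar>\<xi> \<omega> / (c * \<rho>)\<bar> powr \<alpha>)"
  have [measurable]: "Y \<in> borel_measurable M" "t \<in> borel_measurable M"
    by (simp_all add: Y_def t_def)
  have [measurable]: "(\<lambda>\<omega>. U_exp \<alpha> (\<xi> \<omega> / (c * \<rho>))) \<in> borel_measurable M"
    by (rule measurable_compose[OF _ borel_measurable_U_exp[OF \<alpha>]]) simp
  have Y0: "0 \<le> Y \<omega>" for \<omega> using \<rho> by (simp add: Y_def)
  have Y_powr: "Y \<omega> powr u = \<bar>\<xi> \<omega>\<bar> powr u / \<rho> powr u" for \<omega> u
    using \<rho> by (simp add: Y_def powr_divide)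
  have Y_int: "integrable M (\<lambda>\<omega>. Y \<omega> powr u)" if "1 \<le> u" for u
    using int[OF that] by (simp add: Y_powr)
  have Y_moment: "(\<integral>\<omega>. Y \<omega> powr u \<partial>M) \<le> u powr (u / \<alpha>)" if u: "1 \<le> u" for u
  proof -
    define I where "I = (\<integral>\<omega>. \<bar>\<xi> \<omega>\<bar> powr u \<partial>M)"
    have I0: "0 \<le> I" by (simp add: I_def)
    have "I powr (1 / u) \<le> \<rho> * u powr (1 / \<alpha>)"
      using ratio[OF u] u by (simp add: moment_ratio_def I_def divide_le_eq)
    then have "(I powr (1 / u)) powr u \<le> (\<rho> * u powr (1 / \<alpha>)) powr u"
      using u by (intro powr_mono2) auto
    then have "I \<le> \<rho> powr u * u powr (u / \<alpha>)"
      using u \<rho> I0 by (simp add: powr_mult powr_powr)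
    then show ?thesis
      using \<rho> by (simp add: Y_powr I_def[symmetric] divide_le_eq mult.commute)
  qed
  \<comment> \<open>The ratio of the dominating geometric series is \<open>exp 1 / c powr \<alpha> \<le> exp (- 2) \<le> 1 / 4\<close>.\<close>
  have c3: "inverse (c powr \<alpha>) * exp 1 \<le> 1 / 4"
  proof -
    have "2 \<le> exp (1::real)" using exp_ge_add_one_self[of "1::real"] by simp
    then have "2 * 2 \<le> exp (1::real) * exp 1" by (intro mult_mono) auto
    then have "4 * exp 1 \<le> (exp (1::real) * exp 1) * exp 1" by (intro mult_right_mono) auto
    also have "\<dots> = exp 3" by (simp flip: exp_add)
    finally have "4 * exp 1 \<le> c powr \<alpha>" using c by linarith
    then show ?thesis using c by (simp add: field_simps)
  qed
  have term_bound: "(\<integral>\<^sup>+\<omega>. ennreal (t \<omega> ^ k / fact k) \<partial>M) \<le> ennreal ((1 / 4) ^ k)"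
    if k: "1 \<le> k" for k :: nat
  proof -
    define p where "p = \<alpha> * real k"
    define a where "a = inverse (c powr \<alpha>)"
    have a: "0 < a" using c by (simp add: a_def)
    have p: "0 < p" using k \<alpha> by (simp add: p_def)
    have tk: "t \<omega> ^ k = a ^ k * Y \<omega> powr p" for \<omega>
    proof -
      have "t \<omega> = a * Y \<omega> powr \<alpha>"
        using c \<rho> by (simp add: t_def a_def Y_def abs_mult powr_divide powr_mult divide_simps)
      moreover have "(Y \<omega> powr \<alpha>) ^ k = Y \<omega> powr p"
        using k by (cases "Y \<omega> = 0") (auto simp: p_def powr_power mult.commute)
      ultimately show ?thesis by (simp add: power_mult_distrib)
    qed
    have Yp: "integrable M (\<lambda>\<omega>. Y \<omega> powr p) \<and> (\<integral>\<omega>. Y \<omega> powr p \<partial>M) \<le> exp 1 ^ k * fact k"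
    proof (cases "1 \<le> p")
      case True
      have "(\<integral>\<omega>. Y \<omega> powr p \<partial>M) \<le> p powr (p / \<alpha>)" by (rule Y_moment[OF True])
      also have "\<dots> = p ^ k" using \<alpha> p by (simp add: p_def powr_realpow)
      also have "\<dots> \<le> real k ^ k"
        using \<alpha> p by (intro power_mono) (auto simp: p_def mult_left_le_one_le)
      also have "\<dots> \<le> exp 1 ^ k * fact k" by (rule power_le_exp_mult_fact)
      finally show ?thesis using Y_int[OF True] by simp
    next
      case False
      have le: "Y \<omega> powr p \<le> 1 + Y \<omega> powr 1" for \<omega>
      proof (cases "Y \<omega> \<le> 1")
        case True
        then have "Y \<omega> powr p \<le> 1" using p Y0 powr_le1[of p "Y \<omega>"] by simp
        then show ?thesis by (simp add: add_increasing2)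
      next
        case F: False
        then have "Y \<omega> powr p \<le> Y \<omega> powr 1" using False by (intro powr_mono) auto
        then show ?thesis by simp
      qed
      have i1: "integrable M (\<lambda>\<omega>. 1 + Y \<omega> powr 1)" by (intro Bochner_Integration.integrable_add Y_int) auto
      have ip: "integrable M (\<lambda>\<omega>. Y \<omega> powr p)"
        by (rule Bochner_Integration.integrable_bound[OF i1])
          (auto intro!: AE_I2 order_trans[OF le])
      have "(\<integral>\<omega>. Y \<omega> powr p \<partial>M) \<le> (\<integral>\<omega>. 1 + Y \<omega> powr 1 \<partial>M)"
        by (intro integral_mono ip i1 le)
      also have "\<dots> = 1 + (\<integral>\<omega>. Y \<omega> powr 1 \<partial>M)"
        using Y_int[of 1] by (subst Bochner_Integration.integral_add) (auto simp: prob_space)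
      also have "\<dots> \<le> 2" using Y_moment[of 1] by simp
      also have "\<dots> \<le> exp 1" using exp_ge_add_one_self[of "1::real"] by simp
      also have "\<dots> \<le> exp 1 ^ k * fact k"
      proof -
        have "exp (1::real) ^ 1 * 1 \<le> exp 1 ^ k * fact k"
          using k by (intro mult_mono power_increasing fact_ge_1) auto
        then show ?thesis by simp
      qed
      finally show ?thesis using ip by simp
    qed
    have int_t: "integrable M (\<lambda>\<omega>. t \<omega> ^ k / fact k)"
      using Yp by (simp add: tk)
    have "(\<integral>\<omega>. t \<omega> ^ k / fact k \<partial>M) = a ^ k * (\<integral>\<omega>. Y \<omega> powr p \<partial>M) / fact k"
      by (simp add: tk)
    also have "\<dots> \<le> a ^ k * (exp 1 ^ k * fact k) / fact k"
      using Yp a by (intro divide_right_mono mult_left_mono) auto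
    also have "\<dots> = (a * exp 1) ^ k" by (simp add: power_mult_distrib)
    also have "\<dots> \<le> (1 / 4) ^ k"
      using c3 a by (intro power_mono) (auto simp: a_def)
    finally have "(\<integral>\<omega>. t \<omega> ^ k / fact k \<partial>M) \<le> (1 / 4) ^ k" .
    then show ?thesis
      using int_t by (subst nn_integral_eq_integral) (auto simp: t_def intro!: ennreal_leI)
  qed
  have exp_series: "ennreal (exp (t \<omega>) - 1) = (\<Sum>k. ennreal (t \<omega> ^ Suc k / fact (Suc k)))" for \<omega>
  proof -
    have "(\<lambda>k. t \<omega> ^ k / fact k) sums exp (t \<omega>)"
      using exp_converges[of "t \<omega>"] by (simp add: divide_inverse mult.commute)
    then have "(\<lambda>k. t \<omega> ^ Suc k / fact (Suc k)) sums (exp (t \<omega>) - 1)"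
      by (subst sums_Suc_iff) simp
    then show ?thesis
      by (intro suminf_ennreal_eq[symmetric]) (auto simp: t_def)
  qed
  have geometric: "(\<lambda>k. (1 / 4 :: real) ^ Suc k) sums (1 / 3)"
    using sums_mult[OF geometric_sums[of "1 / 4 :: real"], of "1 / 4"] by simp
  have "(\<integral>\<^sup>+\<omega>. ennreal (U_exp \<alpha> (\<xi> \<omega> / (c * \<rho>))) \<partial>M) \<le> (\<integral>\<^sup>+\<omega>. 3 * ennreal (exp (t \<omega>) - 1) \<partial>M)"
  proof (rule nn_integral_mono)
    fix \<omega>
    have "ennreal (U_exp \<alpha> (\<xi> \<omega> / (c * \<rho>))) \<le> ennreal (3 * (exp (t \<omega>) - 1))"
      unfolding t_def by (intro ennreal_leI U_exp_le_exp_minus_one \<alpha>)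
    also have "\<dots> = 3 * ennreal (exp (t \<omega>) - 1)"
      by (subst ennreal_mult) (auto simp: t_def)
    finally show "ennreal (U_exp \<alpha> (\<xi> \<omega> / (c * \<rho>))) \<le> 3 * ennreal (exp (t \<omega>) - 1)" .
  qed
  also have "\<dots> = 3 * (\<Sum>k. \<integral>\<^sup>+\<omega>. ennreal (t \<omega> ^ Suc k / fact (Suc k)) \<partial>M)"
    unfolding exp_series
    by (subst nn_integral_cmult) (auto simp: nn_integral_suminf simp del: power_Suc fact_Suc)
  also have "\<dots> \<le> 3 * (\<Sum>k. ennreal ((1 / 4) ^ Suc k))"
    by (intro mult_left_mono suminf_le term_bound) auto
  also have "\<dots> = 3 * ennreal (1 / 3)"
    by (subst suminf_ennreal_eq[OF _ geometric]) auto
  also have "\<dots> = ennreal (3 * (1 / 3))"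
    by (subst ennreal_mult) auto
  finally have le1: "(\<integral>\<^sup>+\<omega>. ennreal (U_exp \<alpha> (\<xi> \<omega> / (c * \<rho>))) \<partial>M) \<le> 1" by simp
  show "integrable M (\<lambda>\<omega>. U_exp \<alpha> (\<xi> \<omega> / (c * \<rho>)))"
    using le1 by (intro integrableI_nonneg) (auto simp: U_exp_nonneg intro: le_less_trans)
  show "(\<integral>\<omega>. U_exp \<alpha> (\<xi> \<omega> / (c * \<rho>)) \<partial>M) \<le> 1"
    using le1 by (subst integral_eq_nn_integral) (auto simp: U_exp_nonneg enn2real_leI)
qed

section \<open>The constants and the comparison of the norms\<close>

lemma C_psi_U_pos: "0 < C_psi_U \<alpha>"
proof -
  have "0 < 1 + exp (1 / 12) / sqrt (2 * pi)" by (intro add_pos_pos) auto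
  then show ?thesis by (simp add: C_psi_U_def)
qed

lemma C_U_psi_pos: "0 < \<alpha> \<Longrightarrow> 0 < C_U_psi \<alpha>"
  using add_pos_pos[of "exp (2 / \<alpha>)" 1] by (simp add: C_U_psi_def)

lemma exp_3_le_C_psi_U_powr:
  assumes "0 < \<alpha>"
  shows "exp 3 \<le> C_psi_U \<alpha> powr \<alpha>"
proof -
  have q: "1 \<le> 1 + exp (1 / 12) / sqrt (2 * pi)" by simp
  \<comment> \<open>\<open>exp (3 / \<alpha>)\<close> is the product of the factors \<open>exp (2 / \<alpha>)\<close> and \<open>exp (1 / \<alpha>)\<close>; the remaining
      factors are at least \<open>1\<close>.\<close>
  have "exp (3 / \<alpha>) \<le> C_psi_U \<alpha>"
  proof -
    have "exp (3 / \<alpha>) \<le> exp (2 / \<alpha> + 2) * 1 * exp (1 / \<alpha>)"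
      by (simp add: add_divide_distrib[symmetric] flip: exp_add)
    also have "\<dots> \<le> C_psi_U \<alpha>"
      unfolding C_psi_U_def using q assms
      by (intro mult_right_mono mult_left_mono ge_one_powr_ge_zero) auto
    finally show ?thesis .
  qed
  then have "exp (3 / \<alpha>) powr \<alpha> \<le> C_psi_U \<alpha> powr \<alpha>"
    using assms by (intro powr_mono2) auto
  then show ?thesis using assms by (simp add: powr_def)
qed

text \<open>The left-hand side is the constant of \<open>moments_of_integrable_U_exp\<close> for \<open>B = 1\<close>; the two sides
  differ by the factor \<open>2 powr (1 / \<alpha>)\<close>.\<close>

lemma moment_constant_le_inverse_C_U_psi:
  assumes "0 < \<alpha>"
  shows "((1 + exp (2 / \<alpha>)) / (exp 1 * \<alpha>)) powr (1 / \<alpha>) \<le> 1 / C_U_psi \<alpha>"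
proof -
  have e: "exp (1 / \<alpha>) = exp 1 powr (1 / \<alpha>)" by (simp add: powr_def)
  have "C_U_psi \<alpha> = (exp 1 * \<alpha> / (2 * (1 + exp (2 / \<alpha>)))) powr (1 / \<alpha>)"
    unfolding C_U_psi_def e using assms
    by (simp add: powr_mult powr_divide powr_minus_divide add_pos_pos add.commute
        del: distrib_left_numeral)
  then have "1 / C_U_psi \<alpha> = (2 * (1 + exp (2 / \<alpha>)) / (exp 1 * \<alpha>)) powr (1 / \<alpha>)"
    using assms by (simp add: powr_divide)
  moreover have "((1 + exp (2 / \<alpha>)) / (exp 1 * \<alpha>)) powr (1 / \<alpha>) \<le> \<dots>"
    using assms by (intro powr_mono2 divide_right_mono divide_nonneg_pos add_nonneg_nonneg) auto
  ultimately show ?thesis by simp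
qed

theorem theorem5p1:
  fixes M :: "'a measure" and \<alpha> :: real
  assumes "prob_space M" and "0 < \<alpha>" and "\<alpha> < 1"
  shows "let U = U_exp \<alpha>; \<psi> = (\<lambda>u. u powr (1 / \<alpha>)) in
    orlicz_space M U = F_space M \<psi> \<and>
    equivalent_norms_on (orlicz_space M U) (F_norm M \<psi>) (luxemburg_norm M U) \<and>
    (\<forall>\<xi> \<in> orlicz_space M U.
       C_U_psi \<alpha> * F_norm M \<psi> \<xi> \<le> luxemburg_norm M U \<xi> \<and>
       luxemburg_norm M U \<xi> \<le> C_psi_U \<alpha> * F_norm M \<psi> \<xi>)"
proof -
  interpret prob_space M by fact
  note \<alpha> = assms(2,3)
  define U where "U = U_exp \<alpha>"
  define \<psi> where "\<psi> = (\<lambda>u::real. u powr (1 / \<alpha>))"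
  define S where "S \<xi> = {r. r > 0 \<and> integrable M (\<lambda>\<omega>. U (\<xi> \<omega> / r)) \<and>
    (\<integral>\<omega>. U (\<xi> \<omega> / r) \<partial>M) \<le> 1}" for \<xi>
  have lux: "luxemburg_norm M U \<xi> = Inf (S \<xi>)" for \<xi>
    by (simp add: luxemburg_norm_def S_def)
  have bdd: "bdd_below (S \<xi>)" for \<xi>
    by (rule bdd_belowI[of _ 0]) (auto simp: S_def)

  \<comment> \<open>The moment condition yields admissible scales. They bound the infimum from above, and they
      make it an infimum over a nonempty set, which the lower bound requires.\<close>
  have in_S: "C_psi_U \<alpha> * \<rho> \<in> S \<xi>"
    if \<xi>: "\<xi> \<in> F_space M \<psi>" and \<rho>: "0 < \<rho>" "F_norm M \<psi> \<xi> \<le> \<rho>" for \<xi> \<rho>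
  proof -
    have [measurable]: "\<xi> \<in> borel_measurable M" using \<xi> by (simp add: F_space_def)
    have int: "integrable M (\<lambda>\<omega>. \<bar>\<xi> \<omega>\<bar> powr u)" if "1 \<le> u" for u
      using \<xi> that by (simp add: F_space_def)
    have ratio: "moment_ratio M \<psi> \<xi> u \<le> \<rho>" if "1 \<le> u" for u
    proof -
      have "moment_ratio M \<psi> \<xi> u \<le> F_norm M \<psi> \<xi>"
        unfolding F_norm_def using \<xi> that by (intro cSUP_upper) (auto simp: F_space_def)
      then show ?thesis using \<rho> by linarith
    qed
    show ?thesis
      using U_exp_integrable_of_moments[OF \<alpha> \<rho>(1) exp_3_le_C_psi_U_powr[OF \<alpha>(1)] C_psi_U_pos _ int]
        ratio \<rho> C_psi_U_pos[of \<alpha>]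
      by (simp add: S_def U_def \<psi>_def)
  qed

  have F_subset: "\<xi> \<in> orlicz_space M U" if \<xi>: "\<xi> \<in> F_space M \<psi>" for \<xi>
  proof -
    have "C_psi_U \<alpha> * max 1 (F_norm M \<psi> \<xi>) \<in> S \<xi>"
      by (rule in_S[OF \<xi>]) auto
    then show ?thesis
      using \<xi> by (auto simp: S_def orlicz_space_def F_space_def)
  qed

  have orlicz_subset: "\<xi> \<in> F_space M \<psi>" if \<xi>: "\<xi> \<in> orlicz_space M U" for \<xi>
  proof -
    obtain r where r: "0 < r" "integrable M (\<lambda>\<omega>. U_exp \<alpha> (\<xi> \<omega> / r))"
      and [measurable]: "\<xi> \<in> borel_measurable M"
      using \<xi> by (auto simp: orlicz_space_def U_def)
    note * = moments_of_integrable_U_exp[OF \<alpha> r(1) _ r(2) order_refl]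
    show ?thesis
      using * by (auto simp: F_space_def \<psi>_def intro!: bdd_aboveI2)
  qed

  have upper: "luxemburg_norm M U \<xi> \<le> C_psi_U \<alpha> * F_norm M \<psi> \<xi>"
    if \<xi>: "\<xi> \<in> F_space M \<psi>" for \<xi>
  proof -
    have "0 \<le> moment_ratio M \<psi> \<xi> 1" by (simp add: moment_ratio_def \<psi>_def)
    also have "\<dots> \<le> F_norm M \<psi> \<xi>"
      unfolding F_norm_def using \<xi> by (intro cSUP_upper) (auto simp: F_space_def)
    finally have N0: "0 \<le> F_norm M \<psi> \<xi>" .
    \<comment> \<open>The scale must be positive, so the norm itself is approached from above.\<close>
    have "luxemburg_norm M U \<xi> / C_psi_U \<alpha> \<le> F_norm M \<psi> \<xi>"
    proof (rule field_le_epsilon)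
      fix e :: real
      assume "0 < e"
      then have "C_psi_U \<alpha> * (F_norm M \<psi> \<xi> + e) \<in> S \<xi>"
        using N0 by (intro in_S[OF \<xi>]) auto
      then have "luxemburg_norm M U \<xi> \<le> C_psi_U \<alpha> * (F_norm M \<psi> \<xi> + e)"
        unfolding lux by (rule cInf_lower[OF _ bdd])
      then show "luxemburg_norm M U \<xi> / C_psi_U \<alpha> \<le> F_norm M \<psi> \<xi> + e"
        using C_psi_U_pos[of \<alpha>] by (simp add: divide_le_eq mult.commute)
    qed
    then show ?thesis using C_psi_U_pos[of \<alpha>] by (simp add: divide_le_eq mult.commute)
  qed

  have lower: "C_U_psi \<alpha> * F_norm M \<psi> \<xi> \<le> luxemburg_norm M U \<xi>"
    if \<xi>: "\<xi> \<in> F_space M \<psi>" for \<xi>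
    unfolding lux
  proof (rule cInf_greatest)
    show "S \<xi> \<noteq> {}" using in_S[OF \<xi>, of "max 1 (F_norm M \<psi> \<xi>)"] by fastforce
  next
    fix r assume "r \<in> S \<xi>"
    then have r: "0 < r" "integrable M (\<lambda>\<omega>. U_exp \<alpha> (\<xi> \<omega> / r))"
      "(\<integral>\<omega>. U_exp \<alpha> (\<xi> \<omega> / r) \<partial>M) \<le> 1"
      by (auto simp: S_def U_def)
    have [measurable]: "\<xi> \<in> borel_measurable M" using \<xi> by (simp add: F_space_def)
    have "F_norm M \<psi> \<xi> \<le> r * (1 / C_U_psi \<alpha>)"
      unfolding F_norm_def
    proof (rule cSUP_least)
      fix u :: real assume "u \<in> {1..}"
      then have "moment_ratio M \<psi> \<xi> u \<le> r * ((1 + exp (2 / \<alpha>)) / (exp 1 * \<alpha>)) powr (1 / \<alpha>)"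
        unfolding \<psi>_def by (intro moments_of_integrable_U_exp[OF \<alpha> r(1) _ r(2,3)]) auto
      also have "\<dots> \<le> r * (1 / C_U_psi \<alpha>)"
        using r(1) moment_constant_le_inverse_C_U_psi[OF \<alpha>(1)] by (intro mult_left_mono) auto
      finally show "moment_ratio M \<psi> \<xi> u \<le> r * (1 / C_U_psi \<alpha>)" .
    qed simp
    then show "C_U_psi \<alpha> * F_norm M \<psi> \<xi> \<le> r"
      using C_U_psi_pos[OF \<alpha>(1)] by (simp add: le_divide_eq mult.commute)
  qed

  have eq: "orlicz_space M U = F_space M \<psi>"
    using F_subset orlicz_subset by blast
  moreover have "equivalent_norms_on (orlicz_space M U) (F_norm M \<psi>) (luxemburg_norm M U)"
    unfolding equivalent_norms_on_def eq
    using upper lower C_psi_U_pos[of \<alpha>] C_U_psi_pos[OF \<alpha>(1)] by blast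
  ultimately show ?thesis
    using upper lower by (simp add: Let_def U_def[symmetric] \<psi>_def[symmetric])
qed

end
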